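(* Consider a body with an internal rotor and an internal mass that moves in a circle fixed in the body, $\xi=r_o\cos s$, $\eta=r_o\sin s$ with $r_o>0$, in an ideal fluid with constant circulation $\Gamma$ that may be zero or nonzero, as described in the context. Then, for a given initial velocity, the body can be moved by means of the motion of the internal mass in the circle and by rotating the internal rotor from any initial position to any final position, with any initial and final positions of the internal mass. Precisely: for all values of the constants $p_x,p_y,K$ (determined by the initial state and velocities) and all $z_0,z_1$ in the extended space of variables $z=(x,y,\alpha,s)$, there exist $T\ge 0$ and controls $\dot s=\sigma_1(t)$, $\Omega=\Omega(t)$ on $[0,T]$ such that the solution of $$\dot z=V_0(z)+V_1(z)\,\sigma_1(t)+V_2(z)\,\Omega(t),\qquad z(0)=z_0,$$ satisfies $z(T)=z_1$, where $$V_0=R\begin{pmatrix}\bar x\cos\alpha+\bar y\sin\alpha+\chi\\ -\bar x\sin\alpha+\bar y\cos\alpha+\zeta\\ K-\frac{\lambda}{2}(x^2+y^2)-xp_y+yp_x\\ 0\end{pmatrix},\quad V_1=R\begin{pmatrix}-m\frac{d\xi}{ds}\\ -m\frac{d\eta}{ds}\\ m\left(\eta\frac{d\xi}{ds}-\xi\frac{d\eta}{ds}\right)\\ 1\end{pmatrix},\quad V_2=R\begin{pmatrix}0\\ 0\\ -I_r\\ 0\end{pmatrix},\quad R=\begin{pmatrix}QA^{-1}&0\\ 0&1\end{pmatrix}.$$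
   Context: Model: a two-dimensional hydrodynamically asymmetric rigid body (mass $M$, central moment of inertia $I$) moves in an unbounded ideal incompressible fluid. It carries a point mass $m$ at the point $(\xi,\eta)$ in the body frame, inside the body, and a homogeneous circular rotor of mass $m_r$ and central moment of inertia $I_r$, rotating relative to the body with angular velocity $\Omega(t)$. The body frame $O_1\xi\eta$ has its origin $O_1$ at the center of mass of the body--rotor system; $(\xi_b,\eta_b)$ and $(\xi_r,\eta_r)$ are the body-frame positions of the centers of mass of the body and of the rotor, so $M\xi_b+m_r\xi_r=0$, $M\eta_b+m_r\eta_r=0$. The added masses are $\lambda_1\ne\lambda_2$ and the added moment of inertia is $\lambda_6$. The circulation $\Gamma$ around the body is constant; $\lambda=\rho_f\Gamma$, $\zeta=\rho_f\Gamma\mu$, $\chi=\rho_f\Gamma\nu$, where $\rho_f>0$ is the fluid density and $\mu,\nu$ are constants describing the hydrodynamical asymmetry of the body. The position is $q=(x,y,\alpha)\in\mathbb{R}^2\times\mathbb{S}^1$, where $(x,y)$ are the coordinates of $O_1$ in the fixed frame and $\alpha$ is the rotation angle of the body frame. The velocity is $w=(v_1,v_2,\omega)$, where $(v_1,v_2)$ is the velocity of $O_1$ in body axes and $\omega$ is the angular velocity, and $\dot q=Qw$ with $$Q=\begin{pmatrix}\cos\alpha&-\sin\alpha&0\\ \sin\alpha&\cos\alpha&0\\ 0&0&1\end{pmatrix},\quad A=\begin{pmatrix}a_1&0&f\\ 0&a_2&g\\ f&g&b\end{pmatrix},$$ $a_i=M+m+m_r+\lambda_i$ $(i=1,2)$,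 $f=-m\eta$, $g=m\xi$, $b=M(\xi_b^2+\eta_b^2)+I+m(\xi^2+\eta^2)+m_r(\xi_r^2+\eta_r^2)+I_r+\lambda_6$ (so $A$ depends on $s$ through $\xi(s),\eta(s)$). The controlled motion preserves the first integrals $$p_x=(a_1v_1+f\omega+m\dot\xi-\chi)\cos\alpha-(a_2v_2+g\omega+m\dot\eta-\zeta)\sin\alpha+\lambda y,$$ $$p_y=(a_1v_1+f\omega+m\dot\xi-\chi)\sin\alpha+(a_2v_2+g\omega+m\dot\eta-\zeta)\cos\alpha-\lambda x,$$ $$K=fv_1+gv_2+b\omega+m(\xi\dot\eta-\dot\xi\eta)+I_r\Omega+\tfrac{\lambda}{2}(x^2+y^2)+xp_y-yp_x.$$ Expressing $w$ from these integrals, substituting into $\dot q=Qw$ and adjoining $s$ as a variable gives the control system in the claim, with $\bar x=p_x-\lambda y$, $\bar y=p_y+\lambda x$ and $p_x,p_y,K$ constants. The variable $s$ is an angular parameter, $z=(x,y,\alpha,s)\in\mathbb{R}^2\times\mathbb{S}^1\times\mathbb{S}^1$. The controls are $\dot s$ and $\Omega$; admissible controls are piecewise continuous real functions of time, with no a priori bound on their size. *)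

theory Defs
  imports "HOL-Analysis.Analysis" "HOL-Library.Real_Mod"
begin

record fluid_body =
  body_mass :: real           \<comment> \<open>$M$\<close>
  body_inertia :: real        \<comment> \<open>$I$\<close>
  point_mass :: real          \<comment> \<open>$m$\<close>
  rotor_mass :: real          \<comment> \<open>$m_r$\<close>
  rotor_inertia :: real       \<comment> \<open>$I_r$\<close>
  body_xi :: real             \<comment> \<open>$\xi_b$\<close>
  body_eta :: real            \<comment> \<open>$\eta_b$\<close>
  rotor_xi :: real            \<comment> \<open>$\xi_r$\<close>
  rotor_eta :: real           \<comment> \<open>$\eta_r$\<close>
  added_mass1 :: real         \<comment> \<open>$\lambda_1$\<close>
  added_mass2 :: real         \<comment> \<open>$\lambda_2$\<close>
  added_inertia :: real       \<comment> \<open>$\lambda_6$\<close>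
  fluid_density :: real       \<comment> \<open>$\rho_f$\<close>
  circulation :: real         \<comment> \<open>$\Gamma$\<close>
  asym_mu :: real             \<comment> \<open>$\mu$\<close>
  asym_nu :: real             \<comment> \<open>$\nu$\<close>
  circle_radius :: real       \<comment> \<open>$r_o$\<close>

text \<open>The added masses are the diagonal entries of the (positive semidefinite) quadratic form
  giving the kinetic energy of the fluid, hence nonnegative. The circulation and the asymmetry
  constants are arbitrary reals. The two equations put the origin of the body frame at the centre
  of mass of the body and the rotor.\<close>

definition admissible_body :: "fluid_body \<Rightarrow> bool" where
  "admissible_body P \<longleftrightarrow>
     body_mass P > 0 \<and> body_inertia P > 0 \<and> point_mass P > 0 \<and>
     rotor_mass P > 0 \<and> rotor_inertia P > 0 \<and>
     added_mass1 P \<ge> 0 \<and> added_mass2 P \<ge> 0 \<and> added_inertia P \<ge> 0 \<and>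
     added_mass1 P \<noteq> added_mass2 P \<and>
     fluid_density P > 0 \<and> circle_radius P > 0 \<and>
     body_mass P * body_xi P + rotor_mass P * rotor_xi P = 0 \<and>
     body_mass P * body_eta P + rotor_mass P * rotor_eta P = 0"

definition lam :: "fluid_body \<Rightarrow> real" where
  "lam P = fluid_density P * circulation P"

definition zeta_c :: "fluid_body \<Rightarrow> real" where
  "zeta_c P = fluid_density P * circulation P * asym_mu P"

definition chi_c :: "fluid_body \<Rightarrow> real" where
  "chi_c P = fluid_density P * circulation P * asym_nu P"

definition mass_xi :: "fluid_body \<Rightarrow> real \<Rightarrow> real" where
  "mass_xi P s = circle_radius P * cos s"

definition mass_eta :: "fluid_body \<Rightarrow> real \<Rightarrow> real" where
  "mass_eta P s = circle_radius P * sin s"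

definition rot_mat :: "real \<Rightarrow> real^3^3" where
  "rot_mat \<alpha> = vector [vector [cos \<alpha>, - sin \<alpha>, 0],
                        vector [sin \<alpha>, cos \<alpha>, 0],
                        vector [0, 0, 1]]"

definition inertia_mat :: "fluid_body \<Rightarrow> real \<Rightarrow> real^3^3" where
  "inertia_mat P s =
    (let M = body_mass P; m = point_mass P; mr = rotor_mass P;
         \<xi> = mass_xi P s; \<eta> = mass_eta P s;
         a1 = M + m + mr + added_mass1 P;
         a2 = M + m + mr + added_mass2 P;
         f = - m * \<eta>;
         g = m * \<xi>;
         b = M * ((body_xi P)\<^sup>2 + (body_eta P)\<^sup>2) + body_inertia P + m * (\<xi>\<^sup>2 + \<eta>\<^sup>2)
             + mr * ((rotor_xi P)\<^sup>2 + (rotor_eta P)\<^sup>2) + rotor_inertia P + added_inertia P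
     in vector [vector [a1, 0, f],
                vector [0, a2, g],
                vector [f, g, b]])"


text \<open>A state $z = (x,y,\alpha,s)$ is written as a pair of $(x,y,\alpha)$ and $s$, with the angles
  lifted to the reals. All vector fields are $2\pi$-periodic in $\alpha$ and $s$, so the motions on
  $\mathbb{R}^2\times\mathbb{S}^1\times\mathbb{S}^1$ are the projections of the motions of these
  lifts; two lifts represent the same state iff they are related by \<open>same_state\<close>.\<close>

type_synonym state = "(real^3) \<times> real"

definition same_state :: "state \<Rightarrow> state \<Rightarrow> bool" where
  "same_state z z' \<longleftrightarrow>
     fst z $ 1 = fst z' $ 1 \<and> fst z $ 2 = fst z' $ 2 \<and>
     [fst z $ 3 = fst z' $ 3] (rmod (2 * pi)) \<and> [snd z = snd z'] (rmod (2 * pi))"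

text \<open>The block diagonal matrix $R = \mathrm{diag}(Q A^{-1}, 1)$ acting on a vector.\<close>

definition R_app :: "fluid_body \<Rightarrow> state \<Rightarrow> (real^3) \<times> real \<Rightarrow> (real^3) \<times> real" where
  "R_app P z u = ((rot_mat (fst z $ 3) ** matrix_inv (inertia_mat P (snd z))) *v fst u, snd u)"

definition V0 :: "fluid_body \<Rightarrow> real \<Rightarrow> real \<Rightarrow> real \<Rightarrow> state \<Rightarrow> (real^3) \<times> real" where
  "V0 P px py K z =
    (let x = fst z $ 1; y = fst z $ 2; \<alpha> = fst z $ 3;
         xbar = px - lam P * y; ybar = py + lam P * x
     in R_app P z
          (vector [xbar * cos \<alpha> + ybar * sin \<alpha> + chi_c P,
                   - xbar * sin \<alpha> + ybar * cos \<alpha> + zeta_c P,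
                   K - lam P / 2 * (x\<^sup>2 + y\<^sup>2) - x * py + y * px], 0))"

definition V1 :: "fluid_body \<Rightarrow> state \<Rightarrow> (real^3) \<times> real" where
  "V1 P z =
    (let m = point_mass P; s = snd z; \<xi> = mass_xi P s; \<eta> = mass_eta P s;
         d\<xi> = deriv (mass_xi P) s; d\<eta> = deriv (mass_eta P) s
     in R_app P z (vector [- m * d\<xi>, - m * d\<eta>, m * (\<eta> * d\<xi> - \<xi> * d\<eta>)], 1))"

definition V2 :: "fluid_body \<Rightarrow> state \<Rightarrow> (real^3) \<times> real" where
  "V2 P z = R_app P z (vector [0, 0, - rotor_inertia P], 0)"

definition piecewise_continuous_on :: "real \<Rightarrow> real \<Rightarrow> (real \<Rightarrow> real) \<Rightarrow> bool" where
  "piecewise_continuous_on a b f \<longleftrightarrow>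
     (\<exists>D. finite D \<and> (\<forall>t\<in>{a..b} - D. continuous (at t within {a..b}) f)) \<and>
     (\<forall>t\<in>{a..<b}. \<exists>l. (f \<longlongrightarrow> l) (at_right t)) \<and>
     (\<forall>t\<in>{a<..b}. \<exists>l. (f \<longlongrightarrow> l) (at_left t))"

text \<open>Solutions for discontinuous controls are continuous and satisfy the differential equation
  except at finitely many times.\<close>

definition controlled_solution ::
  "fluid_body \<Rightarrow> real \<Rightarrow> real \<Rightarrow> real \<Rightarrow> real \<Rightarrow> (real \<Rightarrow> real) \<Rightarrow> (real \<Rightarrow> real) \<Rightarrow>
   state \<Rightarrow> (real \<Rightarrow> state) \<Rightarrow> bool" where
  "controlled_solution P px py K T \<sigma> \<Omega> z0 z \<longleftrightarrow>
     z 0 = z0 \<and> continuous_on {0..T} z \<and>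
     (\<exists>D. finite D \<and>
       (\<forall>t\<in>{0..T} - D.
         (z has_vector_derivative
            (V0 P px py K (z t) + \<sigma> t *\<^sub>R V1 P (z t) + \<Omega> t *\<^sub>R V2 P (z t)))
         (at t within {0..T})))"

end

theory Submission
  imports Defs
begin

text \<open>The rotor control enters only the angular momentum equation, so the angular velocity
  $\omega$ may be prescribed freely. Put $q = x + iy$, $\theta = s + \alpha$, $\varphi = s - \alpha$
  and $c_\pm = \frac12(1/a_1 \pm 1/a_2)$. Then $X = q + m r_o c_+ e^{i\theta}$ satisfies
  $\dot X = D + i m r_o c_- \dot\theta e^{-i\varphi}$, where $D$ depends on $(X, \theta, \varphi)$
  but not on the controls: up to the drift $D$ this is a rolling wheel with heading $\varphi$ and rolling
  angle $\theta$. Let $\varphi$ make two turns at constant speed while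
  $\dot\theta$ is proportional to $\mathrm{Re}(p e^{i\varphi})$. This restores the angles and, without drift, displaces $X$
  by a nonzero multiple of $p \in \mathbb{C}$. When the manoeuvre is run in a short time $T$ the drift
  contributes $O(T)$, and the trajectory together with the value of $p$ that corrects for the drift
  is the fixed point of a contraction.\<close>

subsection \<open>Lipschitz perturbations over short times\<close>

lemma short_time_solution:
  fixes h :: "real \<Rightarrow> 'a::banach \<times> 'b::banach \<Rightarrow> 'a"
  assumes cont: "\<And>Z p. continuous_on {0..1} Z \<Longrightarrow> continuous_on {0..1} (\<lambda>\<tau>. h \<tau> (Z \<tau>, p))"
    and bound: "\<And>\<tau> u. \<tau> \<in> {0..1} \<Longrightarrow> u \<in> cball (Z0, p0) 1 \<Longrightarrow> norm (h \<tau> u) \<le> B"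
    and lip: "\<And>\<tau> u v. \<tau> \<in> {0..1} \<Longrightarrow> u \<in> cball (Z0, p0) 1 \<Longrightarrow> v \<in> cball (Z0, p0) 1 \<Longrightarrow>
                norm (h \<tau> u - h \<tau> v) \<le> L * dist u v"
    and c: "bounded_linear c"
  obtains T Z p where "T > 0" "Z 0 = Z0" "p = p0 + c (Z 1 - Z0)"
    "\<And>\<tau>. \<tau> \<in> {0..1} \<Longrightarrow> (Z has_vector_derivative T *\<^sub>R h \<tau> (Z \<tau>, p)) (at \<tau> within {0..1})"
proof -
  obtain C where C: "C > 0" "\<And>x. norm (c x) \<le> norm x * C"
    using bounded_linear.pos_bounded[OF c] by blast
  have B0: "B \<ge> 0" using order_trans[OF norm_ge_zero bound[of 0 "(Z0, p0)"]] by simp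
  define T where "T = 1 / (2 * (1 + C) * (1 + B + \<bar>L\<bar>))"
  have T0: "T > 0" unfolding T_def using C(1) B0 by (simp add: add_pos_nonneg)
  have "T * (1 + C) * (1 + B + \<bar>L\<bar>) = 1/2"
  proof -
    have "1 + C \<noteq> 0" "1 + B + \<bar>L\<bar> \<noteq> 0" using C(1) B0 by linarith+
    then show ?thesis unfolding T_def by (simp add: divide_simps)
  qed
  moreover have "T * (1 + C) \<ge> 0" using T0 C(1) by simp
  ultimately have TB: "T * (1 + C) * B \<le> 1/2" and TL: "T * (1 + C) * \<bar>L\<bar> \<le> 1/2"
    using B0 mult_left_mono[of B "1 + B + \<bar>L\<bar>" "T * (1 + C)"]
      mult_left_mono[of "\<bar>L\<bar>" "1 + B + \<bar>L\<bar>" "T * (1 + C)"] by auto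
  define clamp where "clamp t = max 0 (min 1 t)" for t :: real
  have clamp: "clamp t \<in> {0..1}" for t unfolding clamp_def by auto
  have clamp_id: "clamp t = t" if "t \<in> {0..1}" for t using that unfolding clamp_def by auto
  define J where "J u t = integral {0..t} (\<lambda>\<tau>. h \<tau> (apply_bcontfun (fst u) \<tau>, snd u))"
    for u :: "(real \<Rightarrow>\<^sub>C 'a) \<times> 'b" and t
  define F where "F u = (Bcontfun (\<lambda>t. Z0 + T *\<^sub>R J u (clamp t)), p0 + c (T *\<^sub>R J u 1))" for u
  define S where "S = cball (const_bcontfun Z0 :: real \<Rightarrow>\<^sub>C 'a, p0) 1"
  have conth: "continuous_on {0..1} (\<lambda>\<tau>. h \<tau> (apply_bcontfun (fst u) \<tau>, snd u))" for u
    by (rule cont) simp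
  have inth: "(\<lambda>\<tau>. h \<tau> (apply_bcontfun (fst u) \<tau>, snd u)) integrable_on {0..t}" if "t \<in> {0..1}" for u t
    using that by (intro integrable_continuous_real continuous_on_subset[OF conth]) auto
  have contJ: "continuous_on {0..1} (J u)" for u
    unfolding J_def using indefinite_integral_continuous_1[OF inth[of 1 u]] by simp
  have bcont: "(\<lambda>t. Z0 + T *\<^sub>R J u (clamp t)) \<in> bcontfun" for u
  proof -
    have "continuous_on UNIV clamp" unfolding clamp_def by (intro continuous_intros)
    then have 1: "continuous_on UNIV (\<lambda>t. J u (clamp t))"
      using continuous_on_compose2[OF contJ] clamp by blast
    have "bounded (J u ` {0..1})" by (intro compact_imp_bounded compact_continuous_image contJ) simp
    then obtain b where b: "\<And>t. t \<in> {0..1} \<Longrightarrow> norm (J u t) \<le> b" unfolding bounded_iff by blast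
    have "norm (Z0 + T *\<^sub>R J u (clamp t)) \<le> norm Z0 + T * b" for t
    proof -
      have "norm (T *\<^sub>R J u (clamp t)) \<le> T * b" using T0 b[OF clamp[of t]] by simp
      then show ?thesis using norm_triangle_ineq[of Z0 "T *\<^sub>R J u (clamp t)"] by linarith
    qed
    then have "bounded (range (\<lambda>t. Z0 + T *\<^sub>R J u (clamp t)))" unfolding bounded_iff by blast
    then show ?thesis unfolding bcontfun_def using 1 by (auto intro!: continuous_intros)
  qed
  have F1: "apply_bcontfun (fst (F u)) t = Z0 + T *\<^sub>R J u (clamp t)" for u t
    unfolding F_def by (simp add: Bcontfun_inverse[OF bcont])
  have eval: "dist (apply_bcontfun (fst u) t, snd u) (apply_bcontfun (fst v) t, snd v) \<le> dist u v" for u v t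
    unfolding dist_prod_def using dist_bounded[of "fst u" t "fst v"] by (simp add: power_mono)
  have eval_S: "(apply_bcontfun (fst u) t, snd u) \<in> cball (Z0, p0) 1" if "u \<in> S" for u t
    using eval[of "(const_bcontfun Z0, p0)" t u] that
    by (simp add: S_def const_bcontfun.rep_eq)
  have JB: "norm (J u t) \<le> B" if "u \<in> S" "t \<in> {0..1}" for u t
  proof -
    have "norm (J u t) \<le> B * (t - 0)" unfolding J_def
      by (rule integral_bound) (use that in \<open>auto intro!: bound eval_S intro: continuous_on_subset[OF conth]\<close>)
    also have "\<dots> \<le> B" using that B0 by (simp add: mult_left_le)
    finally show ?thesis .
  qed
  have JL: "norm (J u t - J v t) \<le> \<bar>L\<bar> * dist u v" if "u \<in> S" "v \<in> S" "t \<in> {0..1}" for u v t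
  proof -
    have "J u t - J v t = integral {0..t} (\<lambda>\<tau>. h \<tau> (apply_bcontfun (fst u) \<tau>, snd u) - h \<tau> (apply_bcontfun (fst v) \<tau>, snd v))"
      unfolding J_def using that by (intro Henstock_Kurzweil_Integration.integral_diff[symmetric] inth)
    also have "norm \<dots> \<le> (\<bar>L\<bar> * dist u v) * (t - 0)"
    proof (rule integral_bound)
      fix \<tau> assume "\<tau> \<in> {0..t}"
      then have "norm (h \<tau> (apply_bcontfun (fst u) \<tau>, snd u) - h \<tau> (apply_bcontfun (fst v) \<tau>, snd v))
         \<le> L * dist (apply_bcontfun (fst u) \<tau>, snd u) (apply_bcontfun (fst v) \<tau>, snd v)"
        using that by (intro lip eval_S) auto
      also have "\<dots> \<le> \<bar>L\<bar> * dist (apply_bcontfun (fst u) \<tau>, snd u) (apply_bcontfun (fst v) \<tau>, snd v)"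
        by (intro mult_right_mono) auto
      also have "\<dots> \<le> \<bar>L\<bar> * dist u v" by (intro mult_left_mono eval) auto
      finally show "norm (h \<tau> (apply_bcontfun (fst u) \<tau>, snd u) - h \<tau> (apply_bcontfun (fst v) \<tau>, snd v)) \<le> \<bar>L\<bar> * dist u v" .
    qed (use that in \<open>auto intro!: continuous_intros intro: continuous_on_subset[OF conth]\<close>)
    also have "\<dots> \<le> \<bar>L\<bar> * dist u v" using that by (simp add: mult_left_le)
    finally show ?thesis .
  qed
  have dist_F: "dist (F u) w \<le> T * (1 + C) * D"
    if D: "\<And>t. t \<in> {0..1} \<Longrightarrow> norm (J u t - j t) \<le> D"
      and w: "\<And>t. apply_bcontfun (fst w) t = Z0 + T *\<^sub>R j (clamp t)" "snd w = p0 + c (T *\<^sub>R j 1)" for u w j D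
  proof -
    have "dist (fst (F u)) (fst w) \<le> T * D"
    proof (rule dist_bound)
      fix t
      have "dist (apply_bcontfun (fst (F u)) t) (apply_bcontfun (fst w) t) = T * norm (J u (clamp t) - j (clamp t))"
        using T0 by (simp add: F1 w(1) dist_norm flip: scaleR_diff_right)
      then show "dist (apply_bcontfun (fst (F u)) t) (apply_bcontfun (fst w) t) \<le> T * D"
        using D[OF clamp] T0 by simp
    qed
    moreover have "dist (snd (F u)) (snd w) \<le> T * D * C"
    proof -
      have "dist (snd (F u)) (snd w) = norm (c (T *\<^sub>R (J u 1 - j 1)))"
        using bounded_linear.linear[OF c] by (simp add: F_def w(2) dist_norm linear_diff scaleR_diff_right)
      also have "\<dots> \<le> T * norm (J u 1 - j 1) * C" using C(2)[of "T *\<^sub>R (J u 1 - j 1)"] T0 by simp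
      also have "\<dots> \<le> T * D * C" using D[of 1] T0 C(1) by (intro mult_right_mono mult_left_mono) auto
      finally show ?thesis .
    qed
    moreover have "dist (F u) w \<le> dist (fst (F u)) (fst w) + dist (snd (F u)) (snd w)"
      unfolding dist_prod_def by (rule sqrt_sum_squares_le_sum) auto
    ultimately show ?thesis by (simp add: algebra_simps)
  qed
  have "\<exists>!u\<in>S. F u = u"
  proof (rule Banach_fix[of S "1/2" F])
    show "complete S" unfolding S_def by (simp add: complete_eq_closed)
    show "S \<noteq> {}" unfolding S_def by simp
    show "F ` S \<subseteq> S"
    proof (rule image_subsetI)
      fix u assume "u \<in> S"
      then have "dist (F u) (const_bcontfun Z0, p0) \<le> T * (1 + C) * B"
        using JB bounded_linear.linear[OF c]
        by (intro dist_F[of _ "\<lambda>_. 0"]) (auto simp: const_bcontfun.rep_eq linear_0)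
      then show "F u \<in> S" using TB by (simp add: S_def dist_commute)
    qed
    show "dist (F u) (F v) \<le> 1/2 * dist u v" if "u \<in> S" "v \<in> S" for u v
    proof -
      have "dist (F u) (F v) \<le> T * (1 + C) * (\<bar>L\<bar> * dist u v)"
        using that by (intro dist_F[of _ "J v"] JL) (auto simp: F1, simp add: F_def)
      also have "\<dots> \<le> 1/2 * dist u v" using mult_right_mono[OF TL, of "dist u v"] by (simp add: mult.assoc)
      finally show ?thesis .
    qed
  qed auto
  then obtain u where u: "u \<in> S" "F u = u" by blast
  define Z where "Z t = Z0 + T *\<^sub>R J u t" for t
  have Z: "Z t = apply_bcontfun (fst u) t" if "t \<in> {0..1}" for t
    using F1[of u t] u(2) clamp_id[OF that] by (simp add: Z_def)
  show ?thesis
  proof (rule that[of T Z "snd u"])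
    show "Z 0 = Z0" by (simp add: Z_def J_def)
    have "snd u = snd (F u)" using u(2) by simp
    then show "snd u = p0 + c (Z 1 - Z0)" by (simp add: F_def Z_def)
    fix \<tau> :: real assume t: "\<tau> \<in> {0..1}"
    have "(J u has_vector_derivative h \<tau> (apply_bcontfun (fst u) \<tau>, snd u)) (at \<tau> within {0..1})"
      unfolding J_def by (rule integral_has_vector_derivative[OF conth t])
    then show "(Z has_vector_derivative T *\<^sub>R h \<tau> (Z \<tau>, snd u)) (at \<tau> within {0..1})"
      unfolding Z[OF t] by (auto simp: Z_def[abs_def] intro!: derivative_eq_intros)
  qed (rule T0)
qed

definition bdd_lip :: "'t set \<Rightarrow> 'c::metric_space set \<Rightarrow> ('t \<Rightarrow> 'c \<Rightarrow> 'd::real_normed_vector) \<Rightarrow> bool" where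
  "bdd_lip I S f \<longleftrightarrow> (\<exists>B L. \<forall>t\<in>I. \<forall>u\<in>S. norm (f t u) \<le> B \<and> (\<forall>v\<in>S. norm (f t u - f t v) \<le> L * dist u v))"

lemma bdd_lipE:
  assumes "bdd_lip I S f"
  obtains B L where "B \<ge> 0" "L \<ge> 0" "\<And>t u. t \<in> I \<Longrightarrow> u \<in> S \<Longrightarrow> norm (f t u) \<le> B"
    "\<And>t u v. t \<in> I \<Longrightarrow> u \<in> S \<Longrightarrow> v \<in> S \<Longrightarrow> norm (f t u - f t v) \<le> L * dist u v"
proof -
  obtain B L where *: "\<forall>t\<in>I. \<forall>u\<in>S. norm (f t u) \<le> B \<and> (\<forall>v\<in>S. norm (f t u - f t v) \<le> L * dist u v)"
    using assms unfolding bdd_lip_def by blast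
  show ?thesis
  proof (rule that[of "\<bar>B\<bar>" "\<bar>L\<bar>"])
    show "norm (f t u) \<le> \<bar>B\<bar>" if "t \<in> I" "u \<in> S" for t u
      using * that by (meson abs_ge_self order_trans)
    show "norm (f t u - f t v) \<le> \<bar>L\<bar> * dist u v" if "t \<in> I" "u \<in> S" "v \<in> S" for t u v
      using * that mult_right_mono[OF abs_ge_self, of "dist u v" L] by (meson order_trans zero_le_dist)
  qed auto
qed

lemma bdd_lip_const: "bounded (g ` I) \<Longrightarrow> bdd_lip I S (\<lambda>t u. g t)"
  unfolding bdd_lip_def bounded_iff by (metis diff_self dist_commute imageI mult_zero_left norm_zero order_refl)

lemma bdd_lip_add:
  assumes "bdd_lip I S f" "bdd_lip I S g"
  shows "bdd_lip I S (\<lambda>t u. f t u + g t u)"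
proof -
  obtain B L where f: "\<And>t u. t \<in> I \<Longrightarrow> u \<in> S \<Longrightarrow> norm (f t u) \<le> B"
    "\<And>t u v. t \<in> I \<Longrightarrow> u \<in> S \<Longrightarrow> v \<in> S \<Longrightarrow> norm (f t u - f t v) \<le> L * dist u v"
    using bdd_lipE[OF assms(1)] by metis
  obtain B' L' where g: "\<And>t u. t \<in> I \<Longrightarrow> u \<in> S \<Longrightarrow> norm (g t u) \<le> B'"
    "\<And>t u v. t \<in> I \<Longrightarrow> u \<in> S \<Longrightarrow> v \<in> S \<Longrightarrow> norm (g t u - g t v) \<le> L' * dist u v"
    using bdd_lipE[OF assms(2)] by metis
  have "norm (f t u + g t u) \<le> B + B'" if "t \<in> I" "u \<in> S" for t u
    using f(1)[OF that] g(1)[OF that] norm_triangle_ineq[of "f t u" "g t u"] by linarith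
  moreover have "norm (f t u + g t u - (f t v + g t v)) \<le> (L + L') * dist u v" if "t \<in> I" "u \<in> S" "v \<in> S" for t u v
    using f(2)[OF that] g(2)[OF that] norm_diff_triangle_ineq[of "f t u" "g t u" "f t v" "g t v"]
    by (simp add: algebra_simps)
  ultimately show ?thesis unfolding bdd_lip_def by blast
qed

lemma bdd_lip_mult:
  fixes f g :: "'t \<Rightarrow> 'c::metric_space \<Rightarrow> 'd::real_normed_algebra"
  assumes "bdd_lip I S f" "bdd_lip I S g"
  shows "bdd_lip I S (\<lambda>t u. f t u * g t u)"
proof -
  obtain B L where B: "B \<ge> 0" "L \<ge> 0" and f: "\<And>t u. t \<in> I \<Longrightarrow> u \<in> S \<Longrightarrow> norm (f t u) \<le> B"
    "\<And>t u v. t \<in> I \<Longrightarrow> u \<in> S \<Longrightarrow> v \<in> S \<Longrightarrow> norm (f t u - f t v) \<le> L * dist u v"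
    using bdd_lipE[OF assms(1)] by metis
  obtain B' L' where B': "B' \<ge> 0" "L' \<ge> 0" and g: "\<And>t u. t \<in> I \<Longrightarrow> u \<in> S \<Longrightarrow> norm (g t u) \<le> B'"
    "\<And>t u v. t \<in> I \<Longrightarrow> u \<in> S \<Longrightarrow> v \<in> S \<Longrightarrow> norm (g t u - g t v) \<le> L' * dist u v"
    using bdd_lipE[OF assms(2)] by metis
  have "norm (f t u * g t u) \<le> B * B'" if "t \<in> I" "u \<in> S" for t u
    using mult_mono[OF f(1)[OF that] g(1)[OF that]] B norm_mult_ineq[of "f t u" "g t u"]
    by (meson norm_ge_zero order_trans)
  moreover have "norm (f t u * g t u - f t v * g t v) \<le> (L * B' + B * L') * dist u v"
    if "t \<in> I" "u \<in> S" "v \<in> S" for t u v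
  proof -
    have "f t u * g t u - f t v * g t v = (f t u - f t v) * g t u + f t v * (g t u - g t v)"
      by (simp add: algebra_simps)
    also have "norm \<dots> \<le> norm (f t u - f t v) * norm (g t u) + norm (f t v) * norm (g t u - g t v)"
      by (intro norm_triangle_le add_mono norm_mult_ineq)
    also have "\<dots> \<le> (L * dist u v) * B' + B * (L' * dist u v)"
      using that B B' by (intro add_mono mult_mono f g) auto
    finally show ?thesis by (simp add: algebra_simps)
  qed
  ultimately show ?thesis unfolding bdd_lip_def by blast
qed

lemma bdd_lip_compose:
  assumes "bdd_lip I S f" and g: "L-lipschitz_on UNIV g"
  shows "bdd_lip I S (\<lambda>t u. g (f t u))"
proof -
  obtain B L' where f: "\<And>t u. t \<in> I \<Longrightarrow> u \<in> S \<Longrightarrow> norm (f t u) \<le> B"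
    "\<And>t u v. t \<in> I \<Longrightarrow> u \<in> S \<Longrightarrow> v \<in> S \<Longrightarrow> norm (f t u - f t v) \<le> L' * dist u v"
    using bdd_lipE[OF assms(1)] by metis
  have gl: "norm (g x - g y) \<le> L * norm (x - y)" for x y
    using lipschitz_onD[OF g, of x y] by (simp add: dist_norm)
  have L: "L \<ge> 0" using g lipschitz_on_nonneg by blast
  have "norm (g (f t u)) \<le> norm (g 0) + L * B" if "t \<in> I" "u \<in> S" for t u
  proof -
    have "norm (g (f t u)) \<le> norm (g 0) + norm (g (f t u) - g 0)" by (simp add: norm_triangle_sub)
    then show ?thesis using gl[of "f t u" 0] mult_left_mono[OF f(1)[OF that] L] by simp
  qed
  moreover have "norm (g (f t u) - g (f t v)) \<le> (L * L') * dist u v" if "t \<in> I" "u \<in> S" "v \<in> S" for t u v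
    using gl[of "f t u" "f t v"] mult_left_mono[OF f(2)[OF that] L] by (simp add: mult.assoc)
  ultimately show ?thesis unfolding bdd_lip_def by blast
qed

lemma bounded_linear_lipschitz_on_UNIV:
  assumes "bounded_linear g"
  shows "\<exists>L. L-lipschitz_on UNIV g"
  using bounded_linear.lipschitz_boundE[OF assms] by metis

lemma bdd_lip_bounded_linear:
  assumes "bdd_lip I S f" "bounded_linear g"
  shows "bdd_lip I S (\<lambda>t u. g (f t u))"
  using bounded_linear_lipschitz_on_UNIV bdd_lip_compose assms by blast

lemma bdd_lip_id: "bounded S \<Longrightarrow> bdd_lip I S (\<lambda>t u. u)"
  unfolding bdd_lip_def bounded_iff dist_norm by (metis mult_1 order_refl)

lemma lipschitz_on_cis: "1-lipschitz_on UNIV cis"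
proof (rule lipschitz_onI)
  fix x y :: real
  have "cis x - cis y = cis y * (cis (x - y) - 1)" by (simp add: algebra_simps cis_mult)
  then have "dist (cis x) (cis y) = norm (cis (x - y) - 1)"
    by (simp add: dist_norm norm_mult)
  also have "\<dots> = 2 * \<bar>sin ((x - y) / 2)\<bar>" 
    using dist_exp_i_1[of "x-y"] by (simp add: cis_conv_exp mult.commute)
  also have "\<dots> \<le> \<bar>x - y\<bar>" using abs_sin_x_le_abs_x[of "(x - y) / 2"] by simp
  finally show "dist (cis x) (cis y) \<le> 1 * dist x y" by (simp add: dist_real_def)
qed simp

lemma bdd_lip_cis: "bdd_lip I S f \<Longrightarrow> bdd_lip I S (\<lambda>t u. cis (f t u))"
  using bdd_lip_compose lipschitz_on_cis by blast

lemmas bdd_lip_cnj = bdd_lip_bounded_linear[OF _ bounded_linear_cnj]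
  and bdd_lip_Im = bdd_lip_bounded_linear[OF _ bounded_linear_Im]
  and bdd_lip_fst = bdd_lip_bounded_linear[OF bdd_lip_id bounded_linear_fst]
  and bdd_lip_snd = bdd_lip_bounded_linear[OF bdd_lip_id bounded_linear_snd]

lemma bdd_lip_continuous:
  fixes g :: "'t::topological_space \<Rightarrow> 'd::real_normed_vector"
  assumes "compact I" "continuous_on I g"
  shows "bdd_lip I S (\<lambda>t u. g t)"
  using assms by (intro bdd_lip_const compact_imp_bounded compact_continuous_image)

subsection \<open>Concatenation of controlled motions\<close>

lemma continuous_within_transform_open:
  fixes f g :: "'a::t2_space \<Rightarrow> 'b::topological_space"
  assumes "continuous (at t within B) f" "open U" "t \<in> U" "t \<in> A" "A \<inter> U = B \<inter> U"
    and eq: "\<And>x. x \<in> A \<inter> U \<Longrightarrow> f x = g x"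
  shows "continuous (at t within A) g"
proof -
  have "at t within A = at t within B" using assms by (intro at_within_nhd[of t U]) auto
  moreover have "f t = g t" using eq assms(3,4) by blast
  ultimately have "(f \<longlongrightarrow> g t) (at t within A)"
    using assms(1) by (simp add: continuous_within)
  moreover have "eventually (\<lambda>x. f x = g x) (at t within A)"
    unfolding eventually_at_topological using assms(2,3) eq by blast
  ultimately show ?thesis unfolding continuous_within by (rule Lim_transform_eventually)
qed

lemma has_vector_derivative_transform_open:
  assumes f: "(f has_vector_derivative f') (at t within B)" and U: "open U" "t \<in> U" "t \<in> A" "A \<inter> U = B \<inter> U"
    and eq: "\<And>x. x \<in> A \<inter> U \<Longrightarrow> f x = g x"
  shows "(g has_vector_derivative f') (at t within A)"
proof -
  have "at t within A = at t within B" using U by (intro at_within_nhd[of t U]) auto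
  with f have "(f has_vector_derivative f') (at t within A)" by simp
  moreover obtain d where d: "d > 0" "ball t d \<subseteq> U" using U(1,2) openE by blast
  moreover have "f x = g x" if "x \<in> A" "dist x t < d" for x
    using that d(2) by (intro eq) (auto simp: dist_commute)
  ultimately show ?thesis using U(3) has_vector_derivative_transform_within by blast
qed

lemma continuous_on_imp_piecewise_continuous_on:
  assumes "continuous_on {a..b} f"
  shows "piecewise_continuous_on a b f"
  unfolding piecewise_continuous_on_def
proof (intro conjI ballI exI[of _ "{}"])
  show "continuous (at t within {a..b}) f" if "t \<in> {a..b} - {}" for t
    using assms that by (simp add: continuous_on_eq_continuous_within)
  show "\<exists>l. (f \<longlongrightarrow> l) (at_right t)" if "t \<in> {a..<b}" for t
    using continuous_on_Icc_at_rightD[of t b f] continuous_on_subset[OF assms, of "{t..b}"] that by auto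
  show "\<exists>l. (f \<longlongrightarrow> l) (at_left t)" if "t \<in> {a<..b}" for t
    using continuous_on_Icc_at_leftD[of a t f] continuous_on_subset[OF assms, of "{a..t}"] that by auto
qed simp

lemma tendsto_shift_at_right:
  fixes g :: "real \<Rightarrow> 'a::topological_space"
  assumes "(g \<longlongrightarrow> l) (at_right (t - S))"
  shows "((\<lambda>x. g (x - S)) \<longlongrightarrow> l) (at_right t)"
  using assms filterlim_filtermap[of g "nhds l" "\<lambda>x. x - S" "at_right t"]
  by (simp add: filtermap_at_right_shift)

lemma tendsto_shift_at_left:
  fixes g :: "real \<Rightarrow> 'a::topological_space"
  assumes "(g \<longlongrightarrow> l) (at_left (t - S))"
  shows "((\<lambda>x. g (x - S)) \<longlongrightarrow> l) (at_left t)"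
proof -
  have "filtermap (\<lambda>x. x - S) (at_left t) = at_left (t - S)"
    by (simp add: filter_eq_iff eventually_filtermap eventually_at_filter filtermap_nhds_shift[symmetric])
  then show ?thesis using assms filterlim_filtermap[of g "nhds l" "\<lambda>x. x - S" "at_left t"] by simp
qed

lemma image_shift_Icc: "(\<lambda>x. x - S) ` {S..S + T} = {0..T}" for S T :: real
  using image_diff_atLeastAtMost[of S S "S + T"] by simp

lemma piecewise_continuous_on_append:
  assumes f: "piecewise_continuous_on 0 S f" and g: "piecewise_continuous_on 0 T g" and "0 \<le> S" "0 \<le> T"
  shows "piecewise_continuous_on 0 (S + T) (\<lambda>t. if t \<le> S then f t else g (t - S))" (is "piecewise_continuous_on _ _ ?h")
proof -
  obtain D where D: "finite D" "\<And>t. t \<in> {0..S} - D \<Longrightarrow> continuous (at t within {0..S}) f"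
    and fr: "\<And>t. t \<in> {0..<S} \<Longrightarrow> \<exists>l. (f \<longlongrightarrow> l) (at_right t)"
    and fl: "\<And>t. t \<in> {0<..S} \<Longrightarrow> \<exists>l. (f \<longlongrightarrow> l) (at_left t)"
    using f unfolding piecewise_continuous_on_def by blast
  obtain E where E: "finite E" "\<And>t. t \<in> {0..T} - E \<Longrightarrow> continuous (at t within {0..T}) g"
    and gr: "\<And>t. t \<in> {0..<T} \<Longrightarrow> \<exists>l. (g \<longlongrightarrow> l) (at_right t)"
    and gl: "\<And>t. t \<in> {0<..T} \<Longrightarrow> \<exists>l. (g \<longlongrightarrow> l) (at_left t)"
    using g unfolding piecewise_continuous_on_def by blast
  show ?thesis unfolding piecewise_continuous_on_def
  proof (intro conjI ballI exI[of _ "insert S (D \<union> (\<lambda>t. t + S) ` E)"])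
    show "finite (insert S (D \<union> (\<lambda>t. t + S) ` E))" using D E by simp
    fix t assume t: "t \<in> {0..S + T} - insert S (D \<union> (\<lambda>t. t + S) ` E)"
    show "continuous (at t within {0..S + T}) ?h"
    proof (cases "t < S")
      case True
      then show ?thesis using t \<open>0 \<le> T\<close>
        by (intro continuous_within_transform_open[OF D(2), of t "{..<S}"]) auto
    next
      case False
      then have "t > S" using t by auto
      moreover have "t - S \<notin> E" using t by (metis DiffD2 UnCI diff_add_cancel imageI insertCI)
      ultimately have "continuous (at (t - S) within (\<lambda>x. x - S) ` {S..S + T}) g"
        unfolding image_shift_Icc using t by (intro E(2)) auto
      then have "continuous (at t within {S..S + T}) (\<lambda>x. g (x - S))"
        by (intro continuous_within_compose2[of t _ "\<lambda>x. x - S" g] continuous_intros)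
      then show ?thesis
        by (rule continuous_within_transform_open[where U = "{S<..}"]) (use t \<open>t > S\<close> \<open>0 \<le> S\<close> in auto)
    qed
  next
    fix t assume t: "t \<in> {0..<S + T}"
    show "\<exists>l. (?h \<longlongrightarrow> l) (at_right t)"
    proof (cases "t < S")
      case True
      then obtain l where l: "(f \<longlongrightarrow> l) (at_right t)" using fr t by auto
      have e: "eventually (\<lambda>x. f x = ?h x) (at_right t)"
        unfolding eventually_at_right[OF True] using True by (intro exI[of _ S]) auto
      show ?thesis by (intro exI[of _ l] Lim_transform_eventually[OF l e])
    next
      case False
      then obtain l where l: "(g \<longlongrightarrow> l) (at_right (t - S))" using gr[of "t - S"] t by auto
      then have g: "((\<lambda>x. g (x - S)) \<longlongrightarrow> l) (at_right t)" by (rule tendsto_shift_at_right)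
      have e: "eventually (\<lambda>x. g (x - S) = ?h x) (at_right t)"
        using eventually_at_right_less[of t] by eventually_elim (use False in auto)
      show ?thesis by (intro exI[of _ l] Lim_transform_eventually[OF g e])
    qed
  next
    fix t assume t: "t \<in> {0<..S + T}"
    show "\<exists>l. (?h \<longlongrightarrow> l) (at_left t)"
    proof (cases "t \<le> S")
      case True
      then obtain l where l: "(f \<longlongrightarrow> l) (at_left t)" using fl t by auto
      have e: "eventually (\<lambda>x. f x = ?h x) (at_left t)"
        using True by (auto simp: eventually_at_filter)
      show ?thesis by (intro exI[of _ l] Lim_transform_eventually[OF l e])
    next
      case False
      then obtain l where l: "(g \<longlongrightarrow> l) (at_left (t - S))" using gl[of "t - S"] t by auto
      then have g: "((\<lambda>x. g (x - S)) \<longlongrightarrow> l) (at_left t)" by (rule tendsto_shift_at_left)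
      have e: "eventually (\<lambda>x. g (x - S) = ?h x) (at_left t)"
        using False unfolding eventually_at_left_field by (intro exI[of _ S]) auto
      show ?thesis by (intro exI[of _ l] Lim_transform_eventually[OF g e])
    qed
  qed
qed

definition reachable :: "fluid_body \<Rightarrow> real \<Rightarrow> real \<Rightarrow> real \<Rightarrow> state \<Rightarrow> state \<Rightarrow> bool" where
  "reachable P px py K z0 z1 \<longleftrightarrow> (\<exists>T \<sigma> \<Omega> z. T \<ge> 0 \<and>
     piecewise_continuous_on 0 T \<sigma> \<and> piecewise_continuous_on 0 T \<Omega> \<and>
     controlled_solution P px py K T \<sigma> \<Omega> z0 z \<and> z T = z1)"

lemma reachableI:
  assumes "T \<ge> 0" "piecewise_continuous_on 0 T \<sigma>" "piecewise_continuous_on 0 T \<Omega>"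
    "controlled_solution P px py K T \<sigma> \<Omega> z0 z" "z T = z1"
  shows "reachable P px py K z0 z1"
  using assms unfolding reachable_def by blast

lemma reachable_trans:
  assumes "reachable P px py K z0 z1" "reachable P px py K z1 z2"
  shows "reachable P px py K z0 z2"
proof -
  obtain S \<sigma> \<Omega> z where S: "S \<ge> 0" "piecewise_continuous_on 0 S \<sigma>" "piecewise_continuous_on 0 S \<Omega>"
    and z: "controlled_solution P px py K S \<sigma> \<Omega> z0 z" "z S = z1"
    using assms(1) unfolding reachable_def by blast
  obtain T \<sigma>' \<Omega>' z' where T: "T \<ge> 0" "piecewise_continuous_on 0 T \<sigma>'" "piecewise_continuous_on 0 T \<Omega>'"
    and z': "controlled_solution P px py K T \<sigma>' \<Omega>' z1 z'" "z' T = z2"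
    using assms(2) unfolding reachable_def by blast
  define w where "w t = (if t \<le> S then z t else z' (t - S))" for t
  define \<sigma>w where "\<sigma>w t = (if t \<le> S then \<sigma> t else \<sigma>' (t - S))" for t
  define \<Omega>w where "\<Omega>w t = (if t \<le> S then \<Omega> t else \<Omega>' (t - S))" for t
  let ?V = "\<lambda>\<sigma> \<Omega> z t. V0 P px py K (z t) + \<sigma> t *\<^sub>R V1 P (z t) + \<Omega> t *\<^sub>R V2 P (z t)"
  obtain D where D: "finite D"
    "\<And>t. t \<in> {0..S} - D \<Longrightarrow> (z has_vector_derivative ?V \<sigma> \<Omega> z t) (at t within {0..S})"
    using z(1) unfolding controlled_solution_def by blast
  obtain E where E: "finite E"
    "\<And>t. t \<in> {0..T} - E \<Longrightarrow> (z' has_vector_derivative ?V \<sigma>' \<Omega>' z' t) (at t within {0..T})"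
    using z'(1) unfolding controlled_solution_def by blast
  have z'0: "z' 0 = z S" using z z' by (simp add: controlled_solution_def)
  have "controlled_solution P px py K (S + T) \<sigma>w \<Omega>w z0 w"
    unfolding controlled_solution_def
  proof (intro conjI exI[of _ "insert S (D \<union> (\<lambda>t. t + S) ` E)"] ballI)
    show "w 0 = z0" using z S by (simp add: w_def controlled_solution_def)
    have "continuous_on {0..T} z'" using z'(1) by (simp add: controlled_solution_def)
    then have 2: "continuous_on {S..S + T} (\<lambda>t. z' (t - S))"
      by (rule continuous_on_compose2) (auto intro!: continuous_intros)
    have 1: "continuous_on {0..S} z" using z(1) by (simp add: controlled_solution_def)
    have "continuous_on ({0..S} \<union> {S..S + T}) w"
      unfolding w_def by (rule continuous_on_cases[OF _ _ 1 2]) (auto simp: z'0)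
    then show "continuous_on {0..S + T} w" using S(1) T(1) by (simp add: ivl_disj_un_two_touch)
    show "finite (insert S (D \<union> (\<lambda>t. t + S) ` E))" using D E by simp
    fix t assume t: "t \<in> {0..S + T} - insert S (D \<union> (\<lambda>t. t + S) ` E)"
    show "(w has_vector_derivative ?V \<sigma>w \<Omega>w w t) (at t within {0..S + T})"
    proof (cases "t < S")
      case True
      then have V: "?V \<sigma>w \<Omega>w w t = ?V \<sigma> \<Omega> z t" by (simp add: w_def \<sigma>w_def \<Omega>w_def)
      have "(z has_vector_derivative ?V \<sigma>w \<Omega>w w t) (at t within {0..S})"
        unfolding V using t True by (intro D(2)) auto
      then show ?thesis
        by (rule has_vector_derivative_transform_open[where U = "{..<S}"]) (use t True T(1) in \<open>auto simp: w_def\<close>)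
    next
      case False
      then have less: "t > S" using t by auto
      then have V: "?V \<sigma>w \<Omega>w w t = 1 *\<^sub>R ?V \<sigma>' \<Omega>' z' (t - S)" by (simp add: w_def \<sigma>w_def \<Omega>w_def)
      have "t - S \<notin> E" using t by (metis DiffD2 UnCI diff_add_cancel imageI insertCI)
      with less have "(z' has_vector_derivative ?V \<sigma>' \<Omega>' z' (t - S)) (at (t - S) within (\<lambda>x. x - S) ` {S..S + T})"
        unfolding image_shift_Icc using t by (intro E(2)) auto
      then have "(z' \<circ> (\<lambda>x. x - S) has_vector_derivative ?V \<sigma>w \<Omega>w w t) (at t within {S..S + T})"
        unfolding V by (intro vector_diff_chain_within) (auto intro!: derivative_eq_intros)
      then show ?thesis
        by (rule has_vector_derivative_transform_open[where U = "{S<..}"])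
          (use t less S(1) in \<open>auto simp: w_def\<close>)
    qed
  qed
  moreover have "w (S + T) = z2" using z'(2) z'0 T(1) by (cases "T = 0") (auto simp: w_def)
  moreover have "piecewise_continuous_on 0 (S + T) \<sigma>w" "piecewise_continuous_on 0 (S + T) \<Omega>w"
    unfolding \<sigma>w_def \<Omega>w_def using S T by (intro piecewise_continuous_on_append; simp)+
  ultimately show ?thesis using S(1) T(1) by (intro reachableI[of "S + T" \<sigma>w \<Omega>w P px py K z0 w]) auto
qed

subsection \<open>Reduction to the wheel\<close>

definition eff_mass1 :: "fluid_body \<Rightarrow> real" where
  "eff_mass1 P = body_mass P + point_mass P + rotor_mass P + added_mass1 P"

definition eff_mass2 :: "fluid_body \<Rightarrow> real" where
  "eff_mass2 P = body_mass P + point_mass P + rotor_mass P + added_mass2 P"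

definition eff_inertia :: "fluid_body \<Rightarrow> real" where
  "eff_inertia P = body_mass P * ((body_xi P)\<^sup>2 + (body_eta P)\<^sup>2) + body_inertia P
     + point_mass P * (circle_radius P)\<^sup>2
     + rotor_mass P * ((rotor_xi P)\<^sup>2 + (rotor_eta P)\<^sup>2) + rotor_inertia P + added_inertia P"

lemma inertia_mat_eq:
  "inertia_mat P s =
     vector [vector [eff_mass1 P, 0, - point_mass P * (circle_radius P * sin s)],
             vector [0, eff_mass2 P, point_mass P * (circle_radius P * cos s)],
             vector [- point_mass P * (circle_radius P * sin s), point_mass P * (circle_radius P * cos s), eff_inertia P]]"
proof -
  have "(circle_radius P * cos s)\<^sup>2 + (circle_radius P * sin s)\<^sup>2 = (circle_radius P)\<^sup>2"
    by (simp add: power_mult_distrib flip: distrib_left)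
  then show ?thesis
    by (simp add: inertia_mat_def Let_def mass_xi_def mass_eta_def eff_mass1_def eff_mass2_def eff_inertia_def)
qed

lemma eff_mass_gt:
  assumes "admissible_body P"
  shows "eff_mass1 P > point_mass P" "eff_mass2 P > point_mass P" "point_mass P > 0"
  using assms by (auto simp: admissible_body_def eff_mass1_def eff_mass2_def)

lemma inertia_mat_invertible:
  assumes "admissible_body P"
  shows "invertible (inertia_mat P s)"
proof -
  let ?a1 = "eff_mass1 P" and ?a2 = "eff_mass2 P" and ?m = "point_mass P" and ?r = "circle_radius P"
  note gt = eff_mass_gt[OF assms]
  have b: "eff_inertia P > ?m * ?r\<^sup>2"
  proof -
    have "body_mass P * ((body_xi P)\<^sup>2 + (body_eta P)\<^sup>2) \<ge> 0" "rotor_mass P * ((rotor_xi P)\<^sup>2 + (rotor_eta P)\<^sup>2) \<ge> 0"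
      using assms by (auto simp: admissible_body_def)
    then show ?thesis using assms unfolding admissible_body_def eff_inertia_def by linarith
  qed
  have "det (inertia_mat P s) = ?a1 * ?a2 * eff_inertia P
      - ?m\<^sup>2 * ?r\<^sup>2 * (?a1 * (cos s)\<^sup>2 + ?a2 * (sin s)\<^sup>2)"
    unfolding inertia_mat_eq det_3 by (simp add: algebra_simps power2_eq_square)
  moreover have "?m\<^sup>2 * ?r\<^sup>2 * (?a1 * (cos s)\<^sup>2 + ?a2 * (sin s)\<^sup>2) \<le> ?a1 * ?a2 * (?m * ?r\<^sup>2)"
  proof -
    have "?m * ?a1 * (cos s)\<^sup>2 \<le> ?a1 * ?a2 * (cos s)\<^sup>2" "?m * ?a2 * (sin s)\<^sup>2 \<le> ?a1 * ?a2 * (sin s)\<^sup>2"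
      using gt by (auto intro!: mult_right_mono)
    then have "?m * (?a1 * (cos s)\<^sup>2 + ?a2 * (sin s)\<^sup>2) \<le> ?a1 * ?a2 * ((cos s)\<^sup>2 + (sin s)\<^sup>2)"
      unfolding distrib_left by (simp add: mult_ac)
    then have "(?m * ?r\<^sup>2) * (?m * (?a1 * (cos s)\<^sup>2 + ?a2 * (sin s)\<^sup>2)) \<le> (?m * ?r\<^sup>2) * (?a1 * ?a2)"
      using gt(3) by (intro mult_left_mono) auto
    then show ?thesis by (simp add: algebra_simps power2_eq_square)
  qed
  moreover have "?a1 * ?a2 * (?m * ?r\<^sup>2) < ?a1 * ?a2 * eff_inertia P"
    using b gt by (intro mult_strict_left_mono mult_pos_pos) auto
  ultimately show ?thesis unfolding invertible_det_nz by linarith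
qed

lemma matrix_inv_left_vector:
  fixes A :: "real^'n^'n"
  assumes "invertible A"
  shows "matrix_inv A *v (A *v w) = w"
proof -
  have "matrix_inv A ** A = mat 1"
    using assms unfolding invertible_def matrix_inv_def by (metis (mono_tags, lifting) someI_ex)
  then show ?thesis by (simp add: matrix_vector_mul_assoc)
qed

lemma R_app_combine:
  "R_app P z u0 + a *\<^sub>R R_app P z u1 + b *\<^sub>R R_app P z u2 = R_app P z (u0 + a *\<^sub>R u1 + b *\<^sub>R u2)"
  by (simp add: R_app_def matrix_vector_right_distrib matrix_vector_mult_scaleR)

lemma R_app_momentum:
  assumes "admissible_body P"
  shows "R_app P z (inertia_mat P (snd z) *v w, \<sigma>) = (rot_mat (fst z $ 3) *v w, \<sigma>)"
  using matrix_inv_left_vector[OF inertia_mat_invertible[OF assms]]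
  by (simp add: R_app_def flip: matrix_vector_mul_assoc)

lemma deriv_mass_xi: "deriv (mass_xi P) s = - circle_radius P * sin s"
  unfolding mass_xi_def by (rule DERIV_imp_deriv) (auto intro!: derivative_eq_intros)

lemma deriv_mass_eta: "deriv (mass_eta P) s = circle_radius P * cos s"
  unfolding mass_eta_def by (rule DERIV_imp_deriv) (auto intro!: derivative_eq_intros)

definition momentum :: "fluid_body \<Rightarrow> real \<Rightarrow> real \<Rightarrow> complex \<Rightarrow> complex" where
  "momentum P px py q = Complex px py + \<i> * of_real (lam P) * q"

definition offset :: "fluid_body \<Rightarrow> complex" where
  "offset P = Complex (chi_c P) (zeta_c P)"

definition cplus :: "fluid_body \<Rightarrow> real" where
  "cplus P = (1 / eff_mass1 P + 1 / eff_mass2 P) / 2"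

definition cminus :: "fluid_body \<Rightarrow> real" where
  "cminus P = (1 / eff_mass1 P - 1 / eff_mass2 P) / 2"

definition state_of :: "complex \<Rightarrow> real \<Rightarrow> real \<Rightarrow> state" where
  "state_of q \<alpha> s = (vector [Re q, Im q, \<alpha>], s)"

definition drift :: "fluid_body \<Rightarrow> real \<Rightarrow> real \<Rightarrow> complex \<Rightarrow> real \<Rightarrow> complex" where
  "drift P px py q \<alpha> = of_real (cplus P) * momentum P px py q
     + of_real (cminus P) * cis (2 * \<alpha>) * cnj (momentum P px py q)
     + cis \<alpha> * (of_real (cplus P) * offset P + of_real (cminus P) * cnj (offset P))"

definition recoil :: "fluid_body \<Rightarrow> real \<Rightarrow> real \<Rightarrow> complex" where
  "recoil P \<theta> \<phi> = of_real (point_mass P * circle_radius P) * \<i> *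
     (of_real (cminus P) * cis (- \<phi>) - of_real (cplus P) * cis \<theta>)"

lemma body_velocity:
  "cis (- \<alpha>) * (drift P px py q \<alpha> + of_real \<rho> * recoil P (s + \<alpha>) (s - \<alpha>)) =
     Complex ((Re (cis (-\<alpha>) * momentum P px py q) + chi_c P + point_mass P * circle_radius P * \<rho> * sin s) / eff_mass1 P)
             ((Im (cis (-\<alpha>) * momentum P px py q) + zeta_c P - point_mass P * circle_radius P * \<rho> * cos s) / eff_mass2 P)"
    (is "?L = Complex (?N1 / _) (?N2 / _)")
proof -
  let ?p = "momentum P px py q" and ?mr = "of_real (point_mass P * circle_radius P * \<rho>) :: complex"
  have c: "cis (-\<alpha>) * cis (2*\<alpha>) = cis \<alpha>" "cis (-\<alpha>) * cis \<alpha> = 1" "cis (-\<alpha>) * cis (s + \<alpha>) = cis s"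
    "cis (-\<alpha>) * cis (- (s - \<alpha>)) = cis (- s)" by (simp_all add: cis_mult)
  have "?L = of_real (cplus P) * (cis (-\<alpha>) * ?p) + of_real (cminus P) * (cis (-\<alpha>) * cis (2*\<alpha>)) * cnj ?p
     + (cis (-\<alpha>) * cis \<alpha>) * (of_real (cplus P) * offset P + of_real (cminus P) * cnj (offset P))
     + ?mr * \<i> * (of_real (cminus P) * (cis (-\<alpha>) * cis (- (s - \<alpha>))) - of_real (cplus P) * (cis (-\<alpha>) * cis (s + \<alpha>)))"
    unfolding drift_def recoil_def by (simp add: algebra_simps)
  also have "\<dots> = of_real (cplus P) * (cis (-\<alpha>) * ?p + offset P - ?mr * \<i> * cis s)
      + of_real (cminus P) * cnj (cis (-\<alpha>) * ?p + offset P - ?mr * \<i> * cis s)"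
    unfolding c by (simp add: algebra_simps cis_cnj)
  also have "cis (-\<alpha>) * ?p + offset P - ?mr * \<i> * cis s = Complex ?N1 ?N2"
    by (simp add: complex_eq_iff offset_def algebra_simps)
  also have "of_real (cplus P) * Complex ?N1 ?N2 + of_real (cminus P) * cnj (Complex ?N1 ?N2)
    = Complex ((cplus P + cminus P) * ?N1) ((cplus P - cminus P) * ?N2)"
    by (simp add: complex_eq_iff algebra_simps)
  also have "cplus P + cminus P = 1 / eff_mass1 P" by (simp add: cplus_def cminus_def field_simps)
  also have "cplus P - cminus P = 1 / eff_mass2 P" by (simp add: cplus_def cminus_def field_simps)
  finally show ?thesis by simp
qed

text \<open>The formula for \<open>\<Omega>\<close> is the third momentum equation solved for the rotor control.\<close>

lemma control_field:
  assumes P: "admissible_body P" and z: "z = state_of q \<alpha> s"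
    and \<Omega>: "\<Omega> = (K - lam P / 2 * (cmod q)\<^sup>2 - Re q * py + Im q * px
        - point_mass P * (circle_radius P)\<^sup>2 * \<sigma> - eff_inertia P * \<omega>
        + point_mass P * circle_radius P * (sin s * Re (cis (-\<alpha>) * dq) - cos s * Im (cis (-\<alpha>) * dq)))
        / rotor_inertia P"
    and dq: "dq = drift P px py q \<alpha> + of_real (\<omega> + \<sigma>) * recoil P (s + \<alpha>) (s - \<alpha>)"
  shows "V0 P px py K z + \<sigma> *\<^sub>R V1 P z + \<Omega> *\<^sub>R V2 P z = state_of dq \<omega> \<sigma>"
proof -
  let ?m = "point_mass P" and ?r = "circle_radius P"
  define v where "v = cis (-\<alpha>) * dq"
  define u3 where "u3 = K - lam P / 2 * ((Re q)\<^sup>2 + (Im q)\<^sup>2) - Re q * py + Im q * px"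
  have nz: "eff_mass1 P \<noteq> 0" "eff_mass2 P \<noteq> 0" "rotor_inertia P \<noteq> 0"
    using eff_mass_gt[OF P] P by (auto simp: admissible_body_def)
  have v: "eff_mass1 P * Re v = Re (cis (-\<alpha>) * momentum P px py q) + chi_c P + ?m * ?r * (\<omega> + \<sigma>) * sin s"
    "eff_mass2 P * Im v = Im (cis (-\<alpha>) * momentum P px py q) + zeta_c P - ?m * ?r * (\<omega> + \<sigma>) * cos s"
    unfolding v_def dq body_velocity using nz by simp_all
  have \<Omega>': "rotor_inertia P * \<Omega> = u3 - ?m * ?r\<^sup>2 * \<sigma> - eff_inertia P * \<omega> + ?m * ?r * (sin s * Re v - cos s * Im v)"
    unfolding \<Omega> v_def u3_def using nz by (simp add: cmod_power2)
  have sc: "sin s * sin s = 1 - cos s * cos s"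
    using sin_cos_squared_add[of s] by (simp add: power2_eq_square)
  have "V0 P px py K z + \<sigma> *\<^sub>R V1 P z + \<Omega> *\<^sub>R V2 P z =
      R_app P z (inertia_mat P (snd z) *v vector [Re v, Im v, \<omega>], \<sigma>)"
    unfolding V0_def V1_def V2_def Let_def R_app_combine
  proof (rule arg_cong[where f = "R_app P z"], rule prod_eqI)
    let ?u = "(vector [(px - lam P * fst z $ 2) * cos (fst z $ 3) + (py + lam P * fst z $ 1) * sin (fst z $ 3) + chi_c P,
           - (px - lam P * fst z $ 2) * sin (fst z $ 3) + (py + lam P * fst z $ 1) * cos (fst z $ 3) + zeta_c P,
           K - lam P / 2 * ((fst z $ 1)\<^sup>2 + (fst z $ 2)\<^sup>2) - fst z $ 1 * py + fst z $ 2 * px], 0)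
      + \<sigma> *\<^sub>R (vector [- point_mass P * deriv (mass_xi P) (snd z), - point_mass P * deriv (mass_eta P) (snd z),
           point_mass P * (mass_eta P (snd z) * deriv (mass_xi P) (snd z) - mass_xi P (snd z) * deriv (mass_eta P) (snd z))], 1)
      + \<Omega> *\<^sub>R (vector [0, 0, - rotor_inertia P], 0) :: (real^3) \<times> real"
    have "fst ?u $ i = (inertia_mat P (snd z) *v vector [Re v, Im v, \<omega>]) $ i" for i
      using exhaust_3[of i] v \<Omega>'
      by (auto simp: sc z state_of_def inertia_mat_eq matrix_vector_mult_def sum_3 deriv_mass_xi deriv_mass_eta
         mass_xi_def mass_eta_def momentum_def u3_def algebra_simps power2_eq_square)
    then show "fst ?u = fst (inertia_mat P (snd z) *v vector [Re v, Im v, \<omega>], \<sigma>)"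
      by (simp add: vec_eq_iff)
  qed simp
  also have "\<dots> = (rot_mat \<alpha> *v vector [Re v, Im v, \<omega>], \<sigma>)"
    using R_app_momentum[OF P, of z] by (simp add: z state_of_def)
  also have "\<dots> = state_of dq \<omega> \<sigma>"
  proof -
    have dq': "dq = cis \<alpha> * v" by (simp add: v_def cis_mult flip: mult.assoc)
    have "(rot_mat \<alpha> *v vector [Re v, Im v, \<omega>]) $ i = (vector [Re dq, Im dq, \<omega>] :: real^3) $ i" for i
      using exhaust_3[of i] by (auto simp: dq' rot_mat_def matrix_vector_mult_def sum_3)
    then show ?thesis by (simp add: state_of_def vec_eq_iff)
  qed
  finally show ?thesis .
qed

lemma bounded_linear_state_of: "bounded_linear (\<lambda>(q, \<alpha>, s). state_of q \<alpha> s)"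
proof -
  have "linear (\<lambda>(q, \<alpha>, s). state_of q \<alpha> s)"
    by (rule linearI) (auto simp: state_of_def vec_eq_iff forall_3)
  then show ?thesis by (simp add: linear_conv_bounded_linear)
qed

lemma reachable_of_curve:
  assumes P: "admissible_body P" and T: "T > 0"
    and dq: "\<And>\<tau>. \<tau> \<in> {0..1} \<Longrightarrow> (q has_vector_derivative
        (T *\<^sub>R drift P px py (q \<tau>) (\<alpha> \<tau>) + (\<alpha>' \<tau> + s' \<tau>) *\<^sub>R recoil P (s \<tau> + \<alpha> \<tau>) (s \<tau> - \<alpha> \<tau>))) (at \<tau> within {0..1})"
    and d\<alpha>: "\<And>\<tau>. \<tau> \<in> {0..1} \<Longrightarrow> (\<alpha> has_vector_derivative \<alpha>' \<tau>) (at \<tau> within {0..1})"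
    and ds: "\<And>\<tau>. \<tau> \<in> {0..1} \<Longrightarrow> (s has_vector_derivative s' \<tau>) (at \<tau> within {0..1})"
    and cont: "continuous_on {0..1} \<alpha>'" "continuous_on {0..1} s'"
  shows "reachable P px py K (state_of (q 0) (\<alpha> 0) (s 0)) (state_of (q 1) (\<alpha> 1) (s 1))"
proof -
  define dqt where "dqt \<tau> = drift P px py (q \<tau>) (\<alpha> \<tau>) + of_real (\<alpha>' \<tau> / T + s' \<tau> / T) * recoil P (s \<tau> + \<alpha> \<tau>) (s \<tau> - \<alpha> \<tau>)" for \<tau>
  define \<Omega> where "\<Omega> \<tau> = (K - lam P / 2 * (cmod (q \<tau>))\<^sup>2 - Re (q \<tau>) * py + Im (q \<tau>) * px
        - point_mass P * (circle_radius P)\<^sup>2 * (s' \<tau> / T) - eff_inertia P * (\<alpha>' \<tau> / T)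
        + point_mass P * circle_radius P * (sin (s \<tau>) * Re (cis (-\<alpha> \<tau>) * dqt \<tau>) - cos (s \<tau>) * Im (cis (-\<alpha> \<tau>) * dqt \<tau>)))
        / rotor_inertia P" for \<tau>
  define z where "z \<tau> = state_of (q \<tau>) (\<alpha> \<tau>) (s \<tau>)" for \<tau>
  have c: "continuous_on {0..1} q" "continuous_on {0..1} \<alpha>" "continuous_on {0..1} s"
    by (rule continuous_on_vector_derivative, erule dq d\<alpha> ds)+
  have "continuous_on {0..1} dqt"
    unfolding dqt_def drift_def momentum_def recoil_def by (intro continuous_intros c cont)
      (use T in auto)
  moreover have "rotor_inertia P \<noteq> 0" using P by (auto simp: admissible_body_def)
  ultimately have cont\<Omega>: "continuous_on {0..1} \<Omega>"
    unfolding \<Omega>_def by (intro continuous_intros c cont) (use T in auto)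
  have rescale: "continuous_on {0..T} (\<lambda>t. f (t / T))" if "continuous_on {0..1} f" for f :: "real \<Rightarrow> real"
    using T by (intro continuous_on_compose2[OF that] continuous_intros) auto
  have dz: "((\<lambda>t. z (t / T)) has_vector_derivative
      V0 P px py K (z (t / T)) + (s' (t / T) / T) *\<^sub>R V1 P (z (t / T)) + \<Omega> (t / T) *\<^sub>R V2 P (z (t / T)))
      (at t within {0..T})" if t: "t \<in> {0..T}" for t
  proof -
    have t1: "t / T \<in> {0..1}" using t T by simp
    have im: "(\<lambda>t. t / T) ` {0..T} = {0..1}" using T by (simp add: image_divide_atLeastAtMost)
    have "((\<lambda>\<tau>. (\<lambda>(q, \<alpha>, s). state_of q \<alpha> s) (q \<tau>, \<alpha> \<tau>, s \<tau>)) has_vector_derivative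
        (\<lambda>(q, \<alpha>, s). state_of q \<alpha> s) (T *\<^sub>R dqt (t / T), \<alpha>' (t / T), s' (t / T))) (at (t / T) within {0..1})"
      by (rule bounded_linear.has_vector_derivative[OF bounded_linear_state_of])
        (use dq[OF t1] d\<alpha>[OF t1] ds[OF t1] T in \<open>auto intro!: has_vector_derivative_Pair
           simp: dqt_def algebra_simps add_divide_distrib scaleR_conv_of_real\<close>)
    then have "(z has_vector_derivative state_of (T *\<^sub>R dqt (t / T)) (\<alpha>' (t / T)) (s' (t / T))) (at (t / T) within (\<lambda>t. t / T) ` {0..T})"
      by (simp add: z_def[abs_def] im)
    then have "(z \<circ> (\<lambda>t. t / T) has_vector_derivative (1 / T) *\<^sub>R state_of (T *\<^sub>R dqt (t / T)) (\<alpha>' (t / T)) (s' (t / T))) (at t within {0..T})"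
      by (intro vector_diff_chain_within) (use T in \<open>auto intro!: derivative_eq_intros simp: has_vector_derivative_def\<close>)
    moreover have "(1 / T) *\<^sub>R state_of (T *\<^sub>R dqt (t / T)) (\<alpha>' (t / T)) (s' (t / T)) = state_of (dqt (t / T)) (\<alpha>' (t / T) / T) (s' (t / T) / T)"
      using linear_scale[OF bounded_linear.linear[OF bounded_linear_state_of], of "1 / T" "(T *\<^sub>R dqt (t / T), \<alpha>' (t / T), s' (t / T))"] T
      by simp
    moreover have "V0 P px py K (z (t / T)) + (s' (t / T) / T) *\<^sub>R V1 P (z (t / T)) + \<Omega> (t / T) *\<^sub>R V2 P (z (t / T))
       = state_of (dqt (t / T)) (\<alpha>' (t / T) / T) (s' (t / T) / T)"
      by (rule control_field[OF P z_def \<Omega>_def dqt_def])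
    ultimately show ?thesis by (simp add: comp_def)
  qed
  then have "continuous_on {0..T} (\<lambda>t. z (t / T))"
    by (rule continuous_on_vector_derivative)
  then have sol: "controlled_solution P px py K T (\<lambda>t. s' (t / T) / T) (\<lambda>t. \<Omega> (t / T)) (z 0) (\<lambda>t. z (t / T))"
    unfolding controlled_solution_def using dz by (intro conjI exI[of _ "{}"]) auto
  have pc: "piecewise_continuous_on 0 T (\<lambda>t. s' (t / T) / T)" "piecewise_continuous_on 0 T (\<lambda>t. \<Omega> (t / T))"
    using T by (intro continuous_on_imp_piecewise_continuous_on continuous_intros rescale cont cont\<Omega>; simp)+
  have "reachable P px py K (z 0) (z 1)"
    by (rule reachableI[OF _ pc sol]) (use T in auto)
  then show ?thesis by (simp add: z_def)
qed

subsection \<open>Steering\<close>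

lemma cminus_nonzero:
  assumes "admissible_body P"
  shows "cminus P \<noteq> 0"
  using assms by (simp add: cminus_def admissible_body_def eff_mass1_def eff_mass2_def)

definition rolling_angle :: "real \<Rightarrow> real \<Rightarrow> real \<Rightarrow> real \<Rightarrow> complex \<Rightarrow> real \<Rightarrow> real" where
  "rolling_angle \<kappa> \<nu> \<theta>0 \<phi>0 p \<tau> = \<theta>0 + \<nu> * \<tau> + Im (p * (cis (\<phi>0 + \<kappa> * \<tau>) - cis \<phi>0)) / \<kappa>"

definition slip :: "real \<Rightarrow> real \<Rightarrow> real \<Rightarrow> complex \<Rightarrow> real \<Rightarrow> complex" where
  "slip \<kappa> \<nu> \<phi>0 p \<tau> = p * of_real \<tau> / 2 + \<i> * of_real (\<nu> / \<kappa>) * (cis (- (\<phi>0 + \<kappa> * \<tau>)) - cis (- \<phi>0))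
     + \<i> * of_real (1 / (4 * \<kappa>)) * cnj p * (cis (- 2 * (\<phi>0 + \<kappa> * \<tau>)) - cis (- 2 * \<phi>0))"

lemma rolling_angle_deriv:
  assumes "\<kappa> \<noteq> 0"
  shows "(rolling_angle \<kappa> \<nu> \<theta>0 \<phi>0 p has_vector_derivative (\<nu> + Re (p * cis (\<phi>0 + \<kappa> * \<tau>)))) (at \<tau> within A)"
proof -
  have "rolling_angle \<kappa> \<nu> \<theta>0 \<phi>0 p = (\<lambda>\<tau>. \<theta>0 + \<nu> * \<tau> +
      (Re p * (sin (\<phi>0 + \<kappa> * \<tau>) - sin \<phi>0) + Im p * (cos (\<phi>0 + \<kappa> * \<tau>) - cos \<phi>0)) / \<kappa>)"
    by (simp add: rolling_angle_def fun_eq_iff)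
  moreover have "(\<dots> has_real_derivative \<nu> +
      (Re p * (cos (\<phi>0 + \<kappa> * \<tau>) * \<kappa>) - Im p * (sin (\<phi>0 + \<kappa> * \<tau>) * \<kappa>)) / \<kappa>) (at \<tau> within A)"
    by (auto intro!: derivative_eq_intros simp: assms)
  moreover have "(Re p * (cos (\<phi>0 + \<kappa> * \<tau>) * \<kappa>) - Im p * (sin (\<phi>0 + \<kappa> * \<tau>) * \<kappa>)) / \<kappa>
      = Re (p * cis (\<phi>0 + \<kappa> * \<tau>))"
    using assms by (simp add: diff_divide_distrib)
  ultimately show ?thesis by (simp add: has_real_derivative_iff_has_vector_derivative)
qed

lemma slip_deriv:
  assumes "\<kappa> \<noteq> 0"
  shows "(slip \<kappa> \<nu> \<phi>0 p has_vector_derivative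
     (of_real (\<nu> + Re (p * cis (\<phi>0 + \<kappa> * \<tau>))) * cis (- (\<phi>0 + \<kappa> * \<tau>)))) (at \<tau> within A)"
proof -
  let ?\<phi> = "\<phi>0 + \<kappa> * \<tau>"
  have "(slip \<kappa> \<nu> \<phi>0 p has_vector_derivative
     (p / 2 + \<i> * of_real (\<nu> / \<kappa>) * ((- \<kappa>) *\<^sub>R (\<i> * cis (- ?\<phi>)))
       + \<i> * of_real (1 / (4 * \<kappa>)) * cnj p * ((- 2 * \<kappa>) *\<^sub>R (\<i> * cis (- 2 * ?\<phi>))))) (at \<tau> within A)"
    unfolding slip_def[abs_def] has_vector_derivative_def
    by (auto intro!: derivative_eq_intros ext simp: scaleR_conv_of_real algebra_simps)
  also have "p / 2 + \<i> * of_real (\<nu> / \<kappa>) * ((- \<kappa>) *\<^sub>R (\<i> * cis (- ?\<phi>)))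
       + \<i> * of_real (1 / (4 * \<kappa>)) * cnj p * ((- 2 * \<kappa>) *\<^sub>R (\<i> * cis (- 2 * ?\<phi>)))
     = of_real \<nu> * cis (- ?\<phi>) + (p + cnj p * cis (- 2 * ?\<phi>)) / 2"
    using assms by (simp add: scaleR_conv_of_real field_simps)
  also have "(p + cnj p * cis (- 2 * ?\<phi>)) / 2 = of_real (Re (p * cis ?\<phi>)) * cis (- ?\<phi>)"
  proof -
    have "of_real (Re (p * cis ?\<phi>)) = (p * cis ?\<phi> + cnj p * cis (- ?\<phi>)) / 2"
      using complex_add_cnj[of "p * cis ?\<phi>"] by (simp add: cis_cnj)
    then have "of_real (Re (p * cis ?\<phi>)) * cis (- ?\<phi>) =
        (p * (cis ?\<phi> * cis (- ?\<phi>)) + cnj p * (cis (- ?\<phi>) * cis (- ?\<phi>))) / 2"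
      by (simp only: times_divide_eq_left distrib_right mult.assoc)
    moreover have "cis ?\<phi> * cis (- ?\<phi>) = 1" "cis (- ?\<phi>) * cis (- ?\<phi>) = cis (- 2 * ?\<phi>)"
      by (simp_all only: cis_mult) simp_all
    ultimately show ?thesis by simp
  qed
  finally show ?thesis by (simp only: of_real_add distrib_right)
qed

text \<open>The affine relation between \<open>p\<close> and the end point \<open>q1\<close> allows either to be prescribed:
  \<open>c = 0\<close> fixes \<open>p = p0\<close>, and for two full turns a suitable \<open>c\<close> cancels \<open>p\<close>, leaving an equation for \<open>q1\<close>.\<close>

lemma reachable_rolling:
  assumes P: "admissible_body P" and \<kappa>: "\<kappa> \<noteq> 0"
  defines "mr \<equiv> point_mass P * circle_radius P"
  obtains p q1 where
    "reachable P px py K (state_of q0 ((\<theta>0 - \<phi>0) / 2) ((\<theta>0 + \<phi>0) / 2))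
       (state_of q1 ((rolling_angle \<kappa> \<nu> \<theta>0 \<phi>0 p 1 - (\<phi>0 + \<kappa>)) / 2) ((rolling_angle \<kappa> \<nu> \<theta>0 \<phi>0 p 1 + (\<phi>0 + \<kappa>)) / 2))"
    "p = p0 + c * (q1 + of_real (mr * cplus P) * cis (rolling_angle \<kappa> \<nu> \<theta>0 \<phi>0 p 1)
       - \<i> * of_real (mr * cminus P) * slip \<kappa> \<nu> \<phi>0 p 1 - (q0 + of_real (mr * cplus P) * cis \<theta>0))"
proof -
  define \<theta> where "\<theta> = rolling_angle \<kappa> \<nu> \<theta>0 \<phi>0"
  define \<phi> where "\<phi> \<tau> = \<phi>0 + \<kappa> * \<tau>" for \<tau>
  define \<alpha> where "\<alpha> p \<tau> = (\<theta> p \<tau> - \<phi> \<tau>) / 2" for p \<tau>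
  define s where "s p \<tau> = (\<theta> p \<tau> + \<phi> \<tau>) / 2" for p \<tau>
  define pos where "pos \<tau> u = fst u + \<i> * of_real (mr * cminus P) * slip \<kappa> \<nu> \<phi>0 (snd u) \<tau>
      - of_real (mr * cplus P) * cis (\<theta> (snd u) \<tau>)" for \<tau> u
  define h where "h \<tau> u = drift P px py (pos \<tau> u) (\<alpha> (snd u) \<tau>)" for \<tau> u
  define Z0 where "Z0 = q0 + of_real (mr * cplus P) * cis \<theta>0"
  let ?S = "cball (Z0, p0) 1" and ?I = "{0..1} :: real set"
  have S: "bounded ?S" and I: "compact ?I" by auto
  note const = bdd_lip_continuous[OF I]
  note fst = bdd_lip_fst[OF S] and snd = bdd_lip_snd[OF S]
  have "bdd_lip ?I ?S (\<lambda>\<tau> u. (\<theta>0 + \<nu> * \<tau>) + (1 / \<kappa>) * Im (snd u * (cis (\<phi>0 + \<kappa> * \<tau>) - cis \<phi>0)))"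
    by (intro bdd_lip_add bdd_lip_mult bdd_lip_Im const snd continuous_intros)
  then have \<theta>: "bdd_lip ?I ?S (\<lambda>\<tau> u. \<theta> (snd u) \<tau>)"
    by (simp add: \<theta>_def rolling_angle_def)
  have "bdd_lip ?I ?S (\<lambda>\<tau> u. (1/2) * \<theta> (snd u) \<tau> + (- \<phi> \<tau> / 2))"
    unfolding \<phi>_def by (intro bdd_lip_add bdd_lip_mult const \<theta> continuous_intros) auto
  then have \<alpha>: "bdd_lip ?I ?S (\<lambda>\<tau> u. \<alpha> (snd u) \<tau>)" by (simp add: \<alpha>_def diff_divide_distrib)
  have slip: "bdd_lip ?I ?S (\<lambda>\<tau> u. snd u * (of_real \<tau> / 2)
        + \<i> * of_real (\<nu> / \<kappa>) * (cis (- (\<phi>0 + \<kappa> * \<tau>)) - cis (- \<phi>0))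
        + cnj (snd u) * (\<i> * of_real (1 / (4 * \<kappa>)) * (cis (- 2 * (\<phi>0 + \<kappa> * \<tau>)) - cis (- 2 * \<phi>0))))"
    by (intro bdd_lip_add bdd_lip_mult bdd_lip_cnj const snd continuous_intros) auto
  have "bdd_lip ?I ?S (\<lambda>\<tau> u. fst u + (\<i> * of_real (mr * cminus P)) * (snd u * (of_real \<tau> / 2)
        + \<i> * of_real (\<nu> / \<kappa>) * (cis (- (\<phi>0 + \<kappa> * \<tau>)) - cis (- \<phi>0))
        + cnj (snd u) * (\<i> * of_real (1 / (4 * \<kappa>)) * (cis (- 2 * (\<phi>0 + \<kappa> * \<tau>)) - cis (- 2 * \<phi>0))))
      + (- of_real (mr * cplus P)) * cis (\<theta> (snd u) \<tau>))"
    by (intro bdd_lip_add bdd_lip_mult[OF const] slip const fst bdd_lip_cis \<theta> continuous_intros)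
  then have pos: "bdd_lip ?I ?S pos"
    by (simp add: pos_def[abs_def] slip_def mult_ac)
  have mom: "bdd_lip ?I ?S (\<lambda>\<tau> u. momentum P px py (pos \<tau> u))"
    unfolding momentum_def by (intro bdd_lip_add bdd_lip_mult[OF const] const pos continuous_intros)
  have "bdd_lip ?I ?S h"
    unfolding h_def[abs_def] drift_def
    by (intro bdd_lip_add bdd_lip_mult mom bdd_lip_cnj bdd_lip_cis \<alpha> const continuous_intros)
  then obtain B L where BL: "\<And>\<tau> u. \<tau> \<in> ?I \<Longrightarrow> u \<in> ?S \<Longrightarrow> norm (h \<tau> u) \<le> B"
    "\<And>\<tau> u v. \<tau> \<in> ?I \<Longrightarrow> u \<in> ?S \<Longrightarrow> v \<in> ?S \<Longrightarrow> norm (h \<tau> u - h \<tau> v) \<le> L * dist u v"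
    using bdd_lipE by metis
  have cont: "continuous_on ?I (\<lambda>\<tau>. h \<tau> (Z \<tau>, p))" if "continuous_on ?I Z" for Z p
    unfolding h_def pos_def drift_def momentum_def \<alpha>_def \<phi>_def \<theta>_def rolling_angle_def slip_def
    using that by (auto intro!: continuous_intros simp: \<kappa>)
  obtain T Z p where T: "T > 0" and Z: "Z 0 = Z0" "p = p0 + c * (Z 1 - Z0)"
    and dZ: "\<And>\<tau>. \<tau> \<in> ?I \<Longrightarrow> (Z has_vector_derivative T *\<^sub>R h \<tau> (Z \<tau>, p)) (at \<tau> within ?I)"
    using short_time_solution[of h Z0 p0 B L "(*) c"] cont BL bounded_linear_mult_right[of c] by blast
  define q where "q \<tau> = pos \<tau> (Z \<tau>, p)" for \<tau>
  define \<theta>' where "\<theta>' \<tau> = \<nu> + Re (p * cis (\<phi> \<tau>))" for \<tau>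
  have d\<theta>: "(\<theta> p has_vector_derivative \<theta>' \<tau>) (at \<tau> within ?I)" for \<tau>
    unfolding \<theta>_def \<theta>'_def \<phi>_def by (rule rolling_angle_deriv[OF \<kappa>])
  have d\<phi>: "(\<phi> has_vector_derivative \<kappa>) (at \<tau> within ?I)" for \<tau>
    unfolding \<phi>_def[abs_def] by (auto intro!: derivative_eq_intros)
  have d\<alpha>: "(\<alpha> p has_vector_derivative (\<theta>' \<tau> - \<kappa>) / 2) (at \<tau> within ?I)" for \<tau>
    unfolding \<alpha>_def[abs_def] by (intro has_vector_derivative_divide has_vector_derivative_diff d\<theta> d\<phi>)
  have ds: "(s p has_vector_derivative (\<theta>' \<tau> + \<kappa>) / 2) (at \<tau> within ?I)" for \<tau>
    unfolding s_def[abs_def] by (intro has_vector_derivative_divide has_vector_derivative_add d\<theta> d\<phi>)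
  have c\<theta>': "continuous_on ?I \<theta>'" unfolding \<theta>'_def \<phi>_def by (intro continuous_intros)
  have dcis: "((\<lambda>\<tau>. cis (\<theta> p \<tau>)) has_vector_derivative \<theta>' \<tau> *\<^sub>R (\<i> * cis (\<theta> p \<tau>))) (at \<tau> within ?I)" for \<tau>
    using has_derivative_cis[OF d\<theta>[unfolded has_vector_derivative_def]] by (simp add: has_vector_derivative_def)
  have dslip: "(slip \<kappa> \<nu> \<phi>0 p has_vector_derivative of_real (\<theta>' \<tau>) * cis (- \<phi> \<tau>)) (at \<tau> within ?I)" for \<tau>
    unfolding \<theta>'_def \<phi>_def by (rule slip_deriv[OF \<kappa>])
  have dq: "(q has_vector_derivative T *\<^sub>R drift P px py (q \<tau>) (\<alpha> p \<tau>)
      + ((\<theta>' \<tau> - \<kappa>) / 2 + (\<theta>' \<tau> + \<kappa>) / 2) *\<^sub>R recoil P (s p \<tau> + \<alpha> p \<tau>) (s p \<tau> - \<alpha> p \<tau>)) (at \<tau> within ?I)"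
    if "\<tau> \<in> ?I" for \<tau>
  proof -
    have "(q has_vector_derivative T *\<^sub>R h \<tau> (Z \<tau>, p)
        + \<i> * of_real (mr * cminus P) * (of_real (\<theta>' \<tau>) * cis (- \<phi> \<tau>))
        - of_real (mr * cplus P) * (\<theta>' \<tau> *\<^sub>R (\<i> * cis (\<theta> p \<tau>)))) (at \<tau> within ?I)"
      unfolding q_def[abs_def] pos_def fst_conv snd_conv
      by (intro has_vector_derivative_add has_vector_derivative_diff has_vector_derivative_mult_right dZ that dslip dcis)
    moreover have "s p \<tau> + \<alpha> p \<tau> = \<theta> p \<tau>" "s p \<tau> - \<alpha> p \<tau> = \<phi> \<tau>" "(\<theta>' \<tau> - \<kappa>) / 2 + (\<theta>' \<tau> + \<kappa>) / 2 = \<theta>' \<tau>"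
      by (simp_all add: s_def \<alpha>_def field_simps)
    ultimately show ?thesis
      by (simp add: h_def q_def recoil_def mr_def scaleR_conv_of_real algebra_simps)
  qed
  have end_state: "\<alpha> p 1 = (rolling_angle \<kappa> \<nu> \<theta>0 \<phi>0 p 1 - (\<phi>0 + \<kappa>)) / 2"
    "s p 1 = (rolling_angle \<kappa> \<nu> \<theta>0 \<phi>0 p 1 + (\<phi>0 + \<kappa>)) / 2"
    by (simp_all add: \<alpha>_def s_def \<theta>_def \<phi>_def)
  have start: "q 0 = q0" "\<alpha> p 0 = (\<theta>0 - \<phi>0) / 2" "s p 0 = (\<theta>0 + \<phi>0) / 2"
    by (simp_all add: q_def pos_def Z Z0_def slip_def \<theta>_def rolling_angle_def \<alpha>_def s_def \<phi>_def)
  have Z1: "Z 1 = q 1 + of_real (mr * cplus P) * cis (rolling_angle \<kappa> \<nu> \<theta>0 \<phi>0 p 1)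
      - \<i> * of_real (mr * cminus P) * slip \<kappa> \<nu> \<phi>0 p 1"
    by (simp add: q_def pos_def \<theta>_def)
  have "reachable P px py K (state_of (q 0) (\<alpha> p 0) (s p 0)) (state_of (q 1) (\<alpha> p 1) (s p 1))"
    by (rule reachable_of_curve[OF P T dq d\<alpha> ds]) (auto intro!: continuous_intros c\<theta>')
  from that[OF this[unfolded start end_state] Z(2)[unfolded Z1 Z0_def]] show ?thesis .
qed

lemma reachable_translation:
  assumes P: "admissible_body P"
  shows "reachable P px py K (state_of q0 \<alpha> s) (state_of q1 (\<alpha> - 2 * pi) (s + 2 * pi))"
proof -
  define mr where "mr = point_mass P * circle_radius P"
  define k where "k = \<i> * of_real (mr * cminus P) / 2"
  have k: "k \<noteq> 0" using cminus_nonzero[OF P] P by (auto simp: k_def mr_def admissible_body_def)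
  have \<theta>1: "rolling_angle (4 * pi) 0 (s + \<alpha>) (s - \<alpha>) p 1 = s + \<alpha>" for p
  proof -
    have "cis (s - \<alpha> + 4 * pi) = cis (s - \<alpha>)"
      using cis_mult[of "s - \<alpha>" "2 * pi * of_int 2"] cis_multiple_2pi[of 2] by simp
    then show ?thesis by (simp add: rolling_angle_def)
  qed
  have slip1: "slip (4 * pi) 0 (s - \<alpha>) p 1 = p / 2" for p
  proof -
    have "cis (- 2 * (s - \<alpha> + 4 * pi * 1)) = cis (- 2 * (s - \<alpha>))"
      using cis_mult[of "- 2 * (s - \<alpha>)" "2 * pi * of_int (- 4)"] cis_multiple_2pi[of "- 4"]
      by (simp add: algebra_simps)
    then show ?thesis unfolding slip_def by (simp only: diff_self) simp
  qed
  obtain p q where r: "reachable P px py K (state_of q0 ((s + \<alpha> - (s - \<alpha>)) / 2) ((s + \<alpha> + (s - \<alpha>)) / 2))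
       (state_of q ((s + \<alpha> - (s - \<alpha> + 4 * pi)) / 2) ((s + \<alpha> + (s - \<alpha> + 4 * pi)) / 2))"
    and p: "p = (q1 - q0) / k + (- 1 / k) * (q + of_real (mr * cplus P) * cis (s + \<alpha>)
       - \<i> * of_real (mr * cminus P) * (p / 2) - (q0 + of_real (mr * cplus P) * cis (s + \<alpha>)))"
    by (rule reachable_rolling[OF P, of "4 * pi" px py K q0 "s + \<alpha>" "s - \<alpha>" 0 "(q1 - q0) / k" "- 1 / k",
          unfolded \<theta>1 slip1, folded mr_def]) simp
  have "q + of_real (mr * cplus P) * cis (s + \<alpha>) - \<i> * of_real (mr * cminus P) * (p / 2)
      - (q0 + of_real (mr * cplus P) * cis (s + \<alpha>)) = q - k * p - q0"
    by (simp add: k_def)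
  from p[unfolded this] have "k * p = k * ((q1 - q0) / k + (- 1 / k) * (q - k * p - q0))"
    by (rule arg_cong)
  also have "\<dots> = q1 - q0 - (q - k * p - q0)" using k by (simp add: distrib_left right_diff_distrib diff_divide_distrib)
  finally have "q = q1" by simp
  then show ?thesis using r by (simp add: add_divide_distrib diff_divide_distrib)
qed

theorem theorem3p3:
  fixes P :: fluid_body and px py K :: real and z0 z1 :: state
  assumes "admissible_body P"
  shows "\<exists>T \<sigma> \<Omega> z. T \<ge> 0 \<and>
           piecewise_continuous_on 0 T \<sigma> \<and> piecewise_continuous_on 0 T \<Omega> \<and>
           controlled_solution P px py K T \<sigma> \<Omega> z0 z \<and> same_state (z T) z1"
proof -
  have state: "z = state_of (Complex (fst z $ 1) (fst z $ 2)) (fst z $ 3) (snd z)" for z :: state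
    by (simp add: state_of_def prod_eq_iff vec_eq_iff forall_3)
  obtain q0 \<alpha>0 s0 where z0: "z0 = state_of q0 \<alpha>0 s0" using state by blast
  obtain q1 \<alpha>1 s1 where z1: "z1 = state_of q1 \<alpha>1 s1" using state by blast
  \<comment> \<open>One extra turn of the mass keeps the heading \<open>s - \<alpha>\<close> from being constant.\<close>
  obtain s where s: "s = s1 \<or> s = s1 + 2 * pi" "s - \<alpha>1 \<noteq> s0 - \<alpha>0"
    using pi_neq_zero by (cases "s1 - \<alpha>1 = s0 - \<alpha>0") auto
  define \<kappa> where "\<kappa> = (s - \<alpha>1) - (s0 - \<alpha>0)"
  define \<nu> where "\<nu> = (s + \<alpha>1) - (s0 + \<alpha>0)"
  have "\<kappa> \<noteq> 0" using s(2) by (simp add: \<kappa>_def)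
  obtain p q where p: "p = 0" and
    r: "reachable P px py K (state_of q0 ((s0 + \<alpha>0 - (s0 - \<alpha>0)) / 2) ((s0 + \<alpha>0 + (s0 - \<alpha>0)) / 2))
     (state_of q ((rolling_angle \<kappa> \<nu> (s0 + \<alpha>0) (s0 - \<alpha>0) p 1 - (s0 - \<alpha>0 + \<kappa>)) / 2)
        ((rolling_angle \<kappa> \<nu> (s0 + \<alpha>0) (s0 - \<alpha>0) p 1 + (s0 - \<alpha>0 + \<kappa>)) / 2))"
    by (rule reachable_rolling[OF assms \<open>\<kappa> \<noteq> 0\<close>, of px py K q0 "s0 + \<alpha>0" "s0 - \<alpha>0" \<nu> 0 0]) simp
  have "rolling_angle \<kappa> \<nu> (s0 + \<alpha>0) (s0 - \<alpha>0) p 1 = s + \<alpha>1"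
    by (simp add: rolling_angle_def p \<nu>_def)
  then have "reachable P px py K z0 (state_of q \<alpha>1 s)"
    using r by (simp add: z0 \<kappa>_def add_divide_distrib diff_divide_distrib)
  then have "reachable P px py K z0 (state_of q1 (\<alpha>1 - 2 * pi) (s + 2 * pi))"
    using reachable_translation[OF assms] reachable_trans by blast
  then obtain T \<sigma> \<Omega> z where sol: "T \<ge> 0" "piecewise_continuous_on 0 T \<sigma>" "piecewise_continuous_on 0 T \<Omega>"
      "controlled_solution P px py K T \<sigma> \<Omega> z0 z" and zT: "z T = state_of q1 (\<alpha>1 - 2 * pi) (s + 2 * pi)"
    unfolding reachable_def by blast
  have "same_state (state_of q1 (\<alpha>1 - 2 * pi) (s + 2 * pi)) z1"
  proof -
    have "\<exists>n. \<alpha>1 = \<alpha>1 - 2 * pi + of_int n * (2 * pi)" by (rule exI[of _ 1]) simp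
    moreover have "\<exists>n. s1 = s + 2 * pi + of_int n * (2 * pi)"
      using s(1) by (auto intro: exI[of _ "- 1"] exI[of _ "- 2"])
    ultimately show ?thesis by (simp add: same_state_def z1 state_of_def rcong_altdef)
  qed
  then show ?thesis using sol zT by metis
qed

end
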